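(* Let $\mathbf{k}$ be a field of characteristic not equal to $2$ and let $A$ be a $\mathbf{k}$-algebra of finite dimension over $\mathbf{k}$. Let $r=r_-+r_+$ with $r_-\in \mathrm{Alt}^2(A\otimes A)$ and $r_+\in \mathrm{Sym}^2_{bim}(A\otimes A)$. Then $r$ is a solution of the associative Yang-Baxter equation in $A$ if and only if the pair $(\phi(r)_-,\phi(r)_+)=(\phi(r_-),\phi(r_+))$ is an extended $\mathcal{O}$-operator with modification $\phi(r_+)$ of mass $\kappa=-1$ (associated to the $A$-bimodule $(A^*,R^*,L^* )$). In particular, when $r_+=0$, an element $r=r_-\in\mathrm{Alt}^2(A\otimes A)$ is a solution of the associative Yang-Baxter equation in $A$ if and only if $\phi(r_-):A^*\to A$ is an $\mathcal{O}$-operator of weight zero associated to the $A$-bimodule $(A^*,R^*,L^* )$.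
   Context: A $\mathbf{k}$-algebra is an associative, not necessarily unital, algebra over the field $\mathbf{k}$. An $A$-bimodule $(V,\ell,r)$ is a vector space $V$ with linear maps $\ell,r:A\to\mathrm{End}_{\mathbf{k}}(V)$, the first written on the left and the second on the right, such that $\ell(xy)v=\ell(x)(\ell(y)v)$, $v\,r(xy)=(v\,r(x))r(y)$ and $(\ell(x)v)r(y)=\ell(x)(v\,r(y))$. A homomorphism $g$ of bimodules $(V_1,\ell_1,r_1)\to(V_2,\ell_2,r_2)$ is a linear map with $g(\ell_1(x)v)=\ell_2(x)g(v)$ and $g(v\,r_1(x))=g(v)r_2(x)$. $A$ is the bimodule $(A,L,R)$ with $L(x)y=xy$, $yR(x)=yx$. The dual bimodule $(A^*,R^*,L^* )$ is given on $A^*=\mathrm{Hom}_{\mathbf{k}}(A,\mathbf{k})$ by $\langle R^*(x)a^*,y\rangle=\langle a^*,yx\rangle$ (left action) and $\langle a^*L^*(x),y\rangle=\langle a^*,xy\rangle$ (right action). Associative Yang-Baxter equation (AYBE): for $r=\sum_i a_i\otimes b_i\in A\otimes A$, $r_{12}r_{13}+r_{13}r_{23}-r_{23}r_{12}=0$ in $A\otimes A\otimes A$, where $r_{12}r_{13}=\sum_{i,j}a_ia_j\otimes b_i\otimes b_j$, $r_{13}r_{23}=\sum_{i,j}a_i\otimes a_j\otimes b_ib_j$, $r_{23}r_{12}=\sum_{i,j}a_i\otimes a_jb_i\otimes b_j$. Let $\sigma:A\otimes A\to A\otimes A$, $\sigma(a\otimes b)=b\otimes a$, and let $t:\mathrm{Hom}_{\mathbf{k}}(A^*,A)\to\mathrm{Hom}_{\mathbf{k}}(A^*,A)$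 be the transpose, $\langle u,f^t(v)\rangle=\langle v,f(u)\rangle$ for $u,v\in A^*$. The bijection $\phi:A\otimes A\to\mathrm{Hom}_{\mathbf{k}}(A^*,A)$, $\phi(a\otimes b)(u)=\langle u,a\rangle b$, is compatible with $\sigma$ and $t$. $\mathrm{Sym}^2(A\otimes A)$ and $\mathrm{Alt}^2(A\otimes A)$ are the eigenspaces of $\sigma$ for the eigenvalues $1$ and $-1$; $\mathrm{Hom}_{\mathbf{k}}(A^*,A)_+$ and $\mathrm{Hom}_{\mathbf{k}}(A^*,A)_-$ are the eigenspaces of $t$ for the eigenvalues $1$ and $-1$, and $f_\pm$ denote the corresponding components of $f\in\mathrm{Hom}_{\mathbf{k}}(A^*,A)$. $\mathrm{Hom}_{bim}(A^*,A)_+$ is the set of $f\in \mathrm{Hom}_{\mathbf{k}}(A^*,A)_+$ that are $A$-bimodule homomorphisms from $(A^*,R^*,L^* )$ to $(A,L,R)$, and $\mathrm{Sym}^2_{bim}(A\otimes A)=\phi^{-1}(\mathrm{Hom}_{bim}(A^*,A)_+)\subseteq\mathrm{Sym}^2(A\otimes A)$. For an $A$-bimodule $(V,\ell,r)$ and $\kappa\in\mathbf{k}$, a pair $(\alpha,\beta)$ of linear maps $V\to A$ is an extended $\mathcal{O}$-operator with modification $\beta$ of mass $\kappa$ if for all $u,v\in V$: $\kappa\,\ell(\beta(u))v=\kappa\,u\,r(\beta(v))$ and $\alpha(u)\alpha(v)-\alpha(\ell(\alpha(u))v+u\,r(\alpha(v)))=\kappa\,\beta(u)\beta(v)$. An $\mathcal{O}$-operator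 of weight zero associated to $(V,\ell,r)$ is a linear map $\alpha:V\to A$ with $\alpha(u)\alpha(v)=\alpha(\ell(\alpha(u))v)+\alpha(u\,r(\alpha(v)))$ for all $u,v\in V$. *)

theory Defs
  imports
    "HOL-Computational_Algebra.Computational_Algebra"
    "HOL-Library.Function_Algebras"
    "HOL-Library.FuncSet"
    "HOL-Library.Poly_Mapping"
begin

section \<open>Algebras and bimodules\<close>

text \<open>The class \<open>ring\<close> is that of associative rings without a required unit.\<close>

locale k_algebra = vector_space scale
  for scale :: "'k::field \<Rightarrow> 'a::ring \<Rightarrow> 'a" +
  assumes scale_mult_left: "scale c (x * y) = scale c x * y"
    and scale_mult_right: "scale c (x * y) = x * scale c y"

definition finite_dim :: "('k::field \<Rightarrow> 'a::ab_group_add \<Rightarrow> 'a) \<Rightarrow> bool" where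
  "finite_dim scale \<longleftrightarrow> (\<exists>B. finite_dimensional_vector_space scale B)"

text \<open>
  Since the dual space is not a type of its own, spaces other than the algebra are carriers
  \<open>V\<close>, i.e. subspaces of an ambient vector space \<open>(UNIV :: 'v set, scaleV)\<close>.
\<close>

definition linear_on ::
  "'v set \<Rightarrow> ('k \<Rightarrow> 'v::ab_group_add \<Rightarrow> 'v) \<Rightarrow> ('k \<Rightarrow> 'w::ab_group_add \<Rightarrow> 'w) \<Rightarrow> ('v \<Rightarrow> 'w) \<Rightarrow> bool" where
  "linear_on V scaleV scaleW f \<longleftrightarrow>
    (\<forall>u\<in>V. \<forall>v\<in>V. f (u + v) = f u + f v) \<and> (\<forall>c. \<forall>v\<in>V. f (scaleV c v) = scaleW c (f v))"

text \<open>
  In the following, \<open>l x v\<close> stands for \<open>\<ell>(x)v\<close> and \<open>r x v\<close> for \<open>v r(x)\<close>.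
\<close>

definition bimodule ::
  "('k::field \<Rightarrow> 'a::ring \<Rightarrow> 'a) \<Rightarrow> 'v set \<Rightarrow> ('k \<Rightarrow> 'v::ab_group_add \<Rightarrow> 'v)
    \<Rightarrow> ('a \<Rightarrow> 'v \<Rightarrow> 'v) \<Rightarrow> ('a \<Rightarrow> 'v \<Rightarrow> 'v) \<Rightarrow> bool" where
  "bimodule scale V scaleV l r \<longleftrightarrow>
    vector_space scaleV \<and> module.subspace scaleV V \<and>
    (\<forall>x. l x \<in> V \<rightarrow> V \<and> linear_on V scaleV scaleV (l x)) \<and>
    (\<forall>x. r x \<in> V \<rightarrow> V \<and> linear_on V scaleV scaleV (r x)) \<and>
    (\<forall>v\<in>V. linear_on UNIV scale scaleV (\<lambda>x. l x v)) \<and>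
    (\<forall>v\<in>V. linear_on UNIV scale scaleV (\<lambda>x. r x v)) \<and>
    (\<forall>x y. \<forall>v\<in>V. l (x * y) v = l x (l y v)) \<and>
    (\<forall>x y. \<forall>v\<in>V. r (x * y) v = r y (r x v)) \<and>
    (\<forall>x y. \<forall>v\<in>V. r y (l x v) = l x (r y v))"

definition bimodule_hom ::
  "'v set \<Rightarrow> ('k \<Rightarrow> 'v::ab_group_add \<Rightarrow> 'v) \<Rightarrow> ('a \<Rightarrow> 'v \<Rightarrow> 'v) \<Rightarrow> ('a \<Rightarrow> 'v \<Rightarrow> 'v)
    \<Rightarrow> 'w set \<Rightarrow> ('k \<Rightarrow> 'w::ab_group_add \<Rightarrow> 'w) \<Rightarrow> ('a \<Rightarrow> 'w \<Rightarrow> 'w) \<Rightarrow> ('a \<Rightarrow> 'w \<Rightarrow> 'w)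
    \<Rightarrow> ('v \<Rightarrow> 'w) \<Rightarrow> bool" where
  "bimodule_hom V scaleV l1 r1 W scaleW l2 r2 g \<longleftrightarrow>
    g \<in> V \<rightarrow> W \<and> linear_on V scaleV scaleW g \<and>
    (\<forall>x. \<forall>v\<in>V. g (l1 x v) = l2 x (g v)) \<and>
    (\<forall>x. \<forall>v\<in>V. g (r1 x v) = r2 x (g v))"


section \<open>The dual bimodule\<close>

definition dual :: "('k::field \<Rightarrow> 'a::ab_group_add \<Rightarrow> 'a) \<Rightarrow> ('a \<Rightarrow> 'k) set" where
  "dual scale = {u. Vector_Spaces.linear scale (*) u}"

definition dual_scale :: "'k::field \<Rightarrow> ('a \<Rightarrow> 'k) \<Rightarrow> ('a \<Rightarrow> 'k)" where
  "dual_scale c u = (\<lambda>x. c * u x)"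

text \<open>The left action \<open>R\<^sup>*\<close> and the right action \<open>L\<^sup>*\<close>.\<close>

definition dual_left :: "'a::ring \<Rightarrow> ('a \<Rightarrow> 'k) \<Rightarrow> ('a \<Rightarrow> 'k)" where
  "dual_left x u = (\<lambda>y. u (y * x))"

definition dual_right :: "'a::ring \<Rightarrow> ('a \<Rightarrow> 'k) \<Rightarrow> ('a \<Rightarrow> 'k)" where
  "dual_right x u = (\<lambda>y. u (x * y))"


section \<open>\<open>\<O>\<close>-operators\<close>

definition O_operator0 ::
  "('k::field \<Rightarrow> 'a::ring \<Rightarrow> 'a) \<Rightarrow> 'v set \<Rightarrow> ('k \<Rightarrow> 'v::ab_group_add \<Rightarrow> 'v)
    \<Rightarrow> ('a \<Rightarrow> 'v \<Rightarrow> 'v) \<Rightarrow> ('a \<Rightarrow> 'v \<Rightarrow> 'v) \<Rightarrow> ('v \<Rightarrow> 'a) \<Rightarrow> bool" where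
  "O_operator0 scale V scaleV l r \<alpha> \<longleftrightarrow>
    bimodule scale V scaleV l r \<and> linear_on V scaleV scale \<alpha> \<and>
    (\<forall>u\<in>V. \<forall>v\<in>V. \<alpha> u * \<alpha> v = \<alpha> (l (\<alpha> u) v) + \<alpha> (r (\<alpha> v) u))"

definition extended_O_operator ::
  "('k::field \<Rightarrow> 'a::ring \<Rightarrow> 'a) \<Rightarrow> 'v set \<Rightarrow> ('k \<Rightarrow> 'v::ab_group_add \<Rightarrow> 'v)
    \<Rightarrow> ('a \<Rightarrow> 'v \<Rightarrow> 'v) \<Rightarrow> ('a \<Rightarrow> 'v \<Rightarrow> 'v) \<Rightarrow> 'k \<Rightarrow> ('v \<Rightarrow> 'a) \<Rightarrow> ('v \<Rightarrow> 'a) \<Rightarrow> bool" where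
  "extended_O_operator scale V scaleV l r \<kappa> \<alpha> \<beta> \<longleftrightarrow>
    bimodule scale V scaleV l r \<and> linear_on V scaleV scale \<alpha> \<and> linear_on V scaleV scale \<beta> \<and>
    (\<forall>u\<in>V. \<forall>v\<in>V. scaleV \<kappa> (l (\<beta> u) v) = scaleV \<kappa> (r (\<beta> v) u)) \<and>
    (\<forall>u\<in>V. \<forall>v\<in>V.
      \<alpha> u * \<alpha> v - \<alpha> (l (\<alpha> u) v + r (\<alpha> v) u) = scale \<kappa> (\<beta> u * \<beta> v))"


section \<open>Tensor powers\<close>

text \<open>
  \<open>A \<otimes> A\<close> and \<open>A \<otimes> A \<otimes> A\<close> are constructed as free vector spaces on pairs and triples modulo the
  subspace spanned by the multilinearity relations. Their elements are cosets, as \<open>scale\<close> is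
  a term and the quotient therefore cannot be a type.
\<close>

definition coset :: "'m::ab_group_add set \<Rightarrow> 'm \<Rightarrow> 'm set" where
  "coset N p = {q. q - p \<in> N}"

definition coset_add :: "'m::ab_group_add set \<Rightarrow> 'm set \<Rightarrow> 'm set \<Rightarrow> 'm set" where
  "coset_add N X Y = (\<Union>p\<in>X. \<Union>q\<in>Y. coset N (p + q))"

definition coset_uminus :: "'m::ab_group_add set \<Rightarrow> 'm set \<Rightarrow> 'm set" where
  "coset_uminus N X = (\<Union>p\<in>X. coset N (- p))"

definition free_scale :: "'k::field \<Rightarrow> ('x \<Rightarrow>\<^sub>0 'k) \<Rightarrow> ('x \<Rightarrow>\<^sub>0 'k)" where
  "free_scale c p = Poly_Mapping.map ((*) c) p"

abbreviation gen :: "'x \<Rightarrow> ('x \<Rightarrow>\<^sub>0 'k::field)" where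
  "gen x \<equiv> Poly_Mapping.single x 1"

definition relations2 ::
  "('k::field \<Rightarrow> 'a::ab_group_add \<Rightarrow> 'a) \<Rightarrow> ('a \<times> 'a \<Rightarrow>\<^sub>0 'k) set" where
  "relations2 scale =
    {gen (a + a', b) - gen (a, b) - gen (a', b) | a a' b. True} \<union>
    {gen (a, b + b') - gen (a, b) - gen (a, b') | a b b'. True} \<union>
    {gen (scale c a, b) - free_scale c (gen (a, b)) | c a b. True} \<union>
    {gen (a, scale c b) - free_scale c (gen (a, b)) | c a b. True}"

definition relations3 ::
  "('k::field \<Rightarrow> 'a::ab_group_add \<Rightarrow> 'a) \<Rightarrow> ('a \<times> 'a \<times> 'a \<Rightarrow>\<^sub>0 'k) set" where
  "relations3 scale =
    {gen (a + a', b, d) - gen (a, b, d) - gen (a', b, d) | a a' b d. True} \<union>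
    {gen (a, b + b', d) - gen (a, b, d) - gen (a, b', d) | a b b' d. True} \<union>
    {gen (a, b, d + d') - gen (a, b, d) - gen (a, b, d') | a b d d'. True} \<union>
    {gen (scale c a, b, d) - free_scale c (gen (a, b, d)) | c a b d. True} \<union>
    {gen (a, scale c b, d) - free_scale c (gen (a, b, d)) | c a b d. True} \<union>
    {gen (a, b, scale c d) - free_scale c (gen (a, b, d)) | c a b d. True}"

definition null2 :: "('k::field \<Rightarrow> 'a::ab_group_add \<Rightarrow> 'a) \<Rightarrow> ('a \<times> 'a \<Rightarrow>\<^sub>0 'k) set" where
  "null2 scale = module.span free_scale (relations2 scale)"

definition null3 :: "('k::field \<Rightarrow> 'a::ab_group_add \<Rightarrow> 'a) \<Rightarrow> ('a \<times> 'a \<times> 'a \<Rightarrow>\<^sub>0 'k) set" where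
  "null3 scale = module.span free_scale (relations3 scale)"

definition tensor_square ::
  "('k::field \<Rightarrow> 'a::ab_group_add \<Rightarrow> 'a) \<Rightarrow> ('a \<times> 'a \<Rightarrow>\<^sub>0 'k) set set" where
  "tensor_square scale = range (coset (null2 scale))"

text \<open>
  \<open>tensors2 scale [(a\<^sub>1, b\<^sub>1), \<dots>, (a\<^sub>n, b\<^sub>n)]\<close> is \<open>\<Sum>\<^sub>i a\<^sub>i \<otimes> b\<^sub>i\<close>; every element of \<open>A \<otimes> A\<close> is
  of this form.
\<close>

definition tensors2 ::
  "('k::field \<Rightarrow> 'a::ab_group_add \<Rightarrow> 'a) \<Rightarrow> ('a \<times> 'a) list \<Rightarrow> ('a \<times> 'a \<Rightarrow>\<^sub>0 'k) set" where
  "tensors2 scale xs = coset (null2 scale) (\<Sum>x\<leftarrow>xs. gen x)"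

definition tensors3 ::
  "('k::field \<Rightarrow> 'a::ab_group_add \<Rightarrow> 'a) \<Rightarrow> ('a \<times> 'a \<times> 'a) list \<Rightarrow> ('a \<times> 'a \<times> 'a \<Rightarrow>\<^sub>0 'k) set" where
  "tensors3 scale xs = coset (null3 scale) (\<Sum>x\<leftarrow>xs. gen x)"

text \<open>
  The value \<open>F xs\<close> at any presentation \<open>xs\<close> of a given tensor, provided that \<open>F\<close> does not depend
  on the presentation. That it does not is proved below for each use.
\<close>

definition on_tensor ::
  "('k::field \<Rightarrow> 'a::ab_group_add \<Rightarrow> 'a) \<Rightarrow> (('a \<times> 'a) list \<Rightarrow> 'b) \<Rightarrow> ('a \<times> 'a \<Rightarrow>\<^sub>0 'k) set \<Rightarrow> 'b" where
  "on_tensor scale F r = (THE t. \<forall>xs. tensors2 scale xs = r \<longrightarrow> t = F xs)"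


section \<open>The associative Yang-Baxter equation\<close>

definition r12_r13 ::
  "('k::field \<Rightarrow> 'a::ring \<Rightarrow> 'a) \<Rightarrow> ('a \<times> 'a \<Rightarrow>\<^sub>0 'k) set \<Rightarrow> ('a \<times> 'a \<times> 'a \<Rightarrow>\<^sub>0 'k) set" where
  "r12_r13 scale =
    on_tensor scale (\<lambda>xs. tensors3 scale [(a * a', b, b'). (a, b) \<leftarrow> xs, (a', b') \<leftarrow> xs])"

definition r13_r23 ::
  "('k::field \<Rightarrow> 'a::ring \<Rightarrow> 'a) \<Rightarrow> ('a \<times> 'a \<Rightarrow>\<^sub>0 'k) set \<Rightarrow> ('a \<times> 'a \<times> 'a \<Rightarrow>\<^sub>0 'k) set" where
  "r13_r23 scale =
    on_tensor scale (\<lambda>xs. tensors3 scale [(a, a', b * b'). (a, b) \<leftarrow> xs, (a', b') \<leftarrow> xs])"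

definition r23_r12 ::
  "('k::field \<Rightarrow> 'a::ring \<Rightarrow> 'a) \<Rightarrow> ('a \<times> 'a \<Rightarrow>\<^sub>0 'k) set \<Rightarrow> ('a \<times> 'a \<times> 'a \<Rightarrow>\<^sub>0 'k) set" where
  "r23_r12 scale =
    on_tensor scale (\<lambda>xs. tensors3 scale [(a, a' * b, b'). (a, b) \<leftarrow> xs, (a', b') \<leftarrow> xs])"

definition AYBE :: "('k::field \<Rightarrow> 'a::ring \<Rightarrow> 'a) \<Rightarrow> ('a \<times> 'a \<Rightarrow>\<^sub>0 'k) set \<Rightarrow> bool" where
  "AYBE scale r \<longleftrightarrow>
    coset_add (null3 scale) (coset_add (null3 scale) (r12_r13 scale r) (r13_r23 scale r))
      (coset_uminus (null3 scale) (r23_r12 scale r)) = coset (null3 scale) 0"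


section \<open>Symmetric and alternating parts\<close>

definition flip ::
  "('k::field \<Rightarrow> 'a::ab_group_add \<Rightarrow> 'a) \<Rightarrow> ('a \<times> 'a \<Rightarrow>\<^sub>0 'k) set \<Rightarrow> ('a \<times> 'a \<Rightarrow>\<^sub>0 'k) set" where
  "flip scale = on_tensor scale (\<lambda>xs. tensors2 scale [(b, a). (a, b) \<leftarrow> xs])"

definition Alt2 :: "('k::field \<Rightarrow> 'a::ab_group_add \<Rightarrow> 'a) \<Rightarrow> ('a \<times> 'a \<Rightarrow>\<^sub>0 'k) set set" where
  "Alt2 scale = {r \<in> tensor_square scale. flip scale r = coset_uminus (null2 scale) r}"

text \<open>
  Linear maps \<open>A\<^sup>* \<rightarrow> A\<close> are \<open>undefined\<close> outside \<open>A\<^sup>*\<close>, so that equality of functions is equality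
  on \<open>A\<^sup>*\<close>.
\<close>

definition Hom_dual :: "('k::field \<Rightarrow> 'a::ab_group_add \<Rightarrow> 'a) \<Rightarrow> (('a \<Rightarrow> 'k) \<Rightarrow> 'a) set" where
  "Hom_dual scale = {f \<in> extensional (dual scale). linear_on (dual scale) dual_scale scale f}"

text \<open>The transpose takes values in \<open>A\<close> because \<open>A\<close>, being of finite dimension, is reflexive.\<close>

definition transp ::
  "('k::field \<Rightarrow> 'a::ab_group_add \<Rightarrow> 'a) \<Rightarrow> (('a \<Rightarrow> 'k) \<Rightarrow> 'a) \<Rightarrow> (('a \<Rightarrow> 'k) \<Rightarrow> 'a)" where
  "transp scale f = (\<lambda>v\<in>dual scale. THE x. \<forall>u\<in>dual scale. u x = v (f u))"

definition Hom_plus :: "('k::field \<Rightarrow> 'a::ab_group_add \<Rightarrow> 'a) \<Rightarrow> (('a \<Rightarrow> 'k) \<Rightarrow> 'a) set" where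
  "Hom_plus scale = {f \<in> Hom_dual scale. transp scale f = f}"

definition Hom_minus :: "('k::field \<Rightarrow> 'a::ab_group_add \<Rightarrow> 'a) \<Rightarrow> (('a \<Rightarrow> 'k) \<Rightarrow> 'a) set" where
  "Hom_minus scale = {f \<in> Hom_dual scale. transp scale f = (\<lambda>u\<in>dual scale. - f u)}"

definition plus_part ::
  "('k::field \<Rightarrow> 'a::ab_group_add \<Rightarrow> 'a) \<Rightarrow> (('a \<Rightarrow> 'k) \<Rightarrow> 'a) \<Rightarrow> (('a \<Rightarrow> 'k) \<Rightarrow> 'a)" where
  "plus_part scale f =
    (THE g. g \<in> Hom_plus scale \<and> (\<exists>h\<in>Hom_minus scale. f = (\<lambda>u\<in>dual scale. g u + h u)))"

definition minus_part ::
  "('k::field \<Rightarrow> 'a::ab_group_add \<Rightarrow> 'a) \<Rightarrow> (('a \<Rightarrow> 'k) \<Rightarrow> 'a) \<Rightarrow> (('a \<Rightarrow> 'k) \<Rightarrow> 'a)" where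
  "minus_part scale f =
    (THE h. h \<in> Hom_minus scale \<and> (\<exists>g\<in>Hom_plus scale. f = (\<lambda>u\<in>dual scale. g u + h u)))"

definition phi ::
  "('k::field \<Rightarrow> 'a::ab_group_add \<Rightarrow> 'a) \<Rightarrow> ('a \<times> 'a \<Rightarrow>\<^sub>0 'k) set \<Rightarrow> (('a \<Rightarrow> 'k) \<Rightarrow> 'a)" where
  "phi scale = on_tensor scale (\<lambda>xs. \<lambda>u\<in>dual scale. \<Sum>(a, b)\<leftarrow>xs. scale (u a) b)"

definition Hom_bim_plus :: "('k::field \<Rightarrow> 'a::ring \<Rightarrow> 'a) \<Rightarrow> (('a \<Rightarrow> 'k) \<Rightarrow> 'a) set" where
  "Hom_bim_plus scale =
    {f \<in> Hom_plus scale.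
      bimodule_hom (dual scale) dual_scale dual_left dual_right UNIV scale (*) (\<lambda>x y. y * x) f}"

definition Sym2_bim :: "('k::field \<Rightarrow> 'a::ring \<Rightarrow> 'a) \<Rightarrow> ('a \<times> 'a \<Rightarrow>\<^sub>0 'k) set set" where
  "Sym2_bim scale = {r \<in> tensor_square scale. phi scale r \<in> Hom_bim_plus scale}"


section \<open>Independence of the presentation\<close>

lemma lookup_free_scale: "Poly_Mapping.lookup (free_scale c p) x = c * Poly_Mapping.lookup p x"
  by (simp add: free_scale_def Poly_Mapping.map.rep_eq when_def)

lemma vector_space_free_scale:
  "vector_space (free_scale :: 'k::field \<Rightarrow> ('x \<Rightarrow>\<^sub>0 'k) \<Rightarrow> ('x \<Rightarrow>\<^sub>0 'k))"
  by unfold_locales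
    (auto intro!: poly_mapping_eqI simp: lookup_free_scale lookup_add algebra_simps)

interpretation free: vector_space "free_scale :: 'k::field \<Rightarrow> ('x \<Rightarrow>\<^sub>0 'k) \<Rightarrow> ('x \<Rightarrow>\<^sub>0 'k)"
  by (rule vector_space_free_scale)

lemma subspace_null2: "free.subspace (null2 scale)"
  unfolding null2_def by (rule free.subspace_span)

lemma subspace_null3: "free.subspace (null3 scale)"
  unfolding null3_def by (rule free.subspace_span)

lemma coset_eq_iff:
  assumes "free.subspace N"
  shows "coset N p = coset N q \<longleftrightarrow> p - q \<in> N"
proof
  assume eq: "coset N p = coset N q"
  have "p \<in> coset N p"
    using free.subspace_0[OF assms] by (simp add: coset_def)
  with eq show "p - q \<in> N" by (simp add: coset_def)
next
  assume pq: "p - q \<in> N"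
  have "x - p \<in> N \<longleftrightarrow> x - q \<in> N" for x
    using free.subspace_add[OF assms pq, of "x - p"] free.subspace_diff[OF assms _ pq, of "x - q"]
    by (auto simp: algebra_simps)
  then show "coset N p = coset N q" by (simp add: coset_def)
qed

lemma coset_add_coset:
  assumes "free.subspace N"
  shows "coset_add N (coset N p) (coset N q) = coset N (p + q)"
proof -
  have "coset N (p' + q') = coset N (p + q)" if "p' \<in> coset N p" "q' \<in> coset N q" for p' q'
  proof -
    have "p' - p \<in> N" "q' - q \<in> N" using that by (simp_all add: coset_def)
    from free.subspace_add[OF assms this] show ?thesis
      by (simp add: coset_eq_iff[OF assms] algebra_simps)
  qed
  moreover have "p \<in> coset N p" "q \<in> coset N q"
    using free.subspace_0[OF assms] by (simp_all add: coset_def)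
  ultimately show ?thesis unfolding coset_add_def by blast
qed

lemma coset_uminus_coset:
  assumes "free.subspace N"
  shows "coset_uminus N (coset N p) = coset N (- p)"
proof -
  have "coset N (- p') = coset N (- p)" if "p' \<in> coset N p" for p'
  proof -
    have "p' - p \<in> N" using that by (simp add: coset_def)
    from free.subspace_neg[OF assms this] show ?thesis
      by (simp add: coset_eq_iff[OF assms] algebra_simps)
  qed
  moreover have "p \<in> coset N p"
    using free.subspace_0[OF assms] by (simp add: coset_def)
  ultimately show ?thesis unfolding coset_uminus_def by blast
qed

text \<open>The linear extension of a map defined on generators.\<close>

definition lin_ext :: "('k::field \<Rightarrow> 'm::ab_group_add \<Rightarrow> 'm) \<Rightarrow> ('x \<Rightarrow> 'm) \<Rightarrow> ('x \<Rightarrow>\<^sub>0 'k) \<Rightarrow> 'm" where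
  "lin_ext s f p = (\<Sum>x\<in>Poly_Mapping.keys p. s (Poly_Mapping.lookup p x) (f x))"

context vector_space
begin

lemma lin_ext_superset:
  "finite K \<Longrightarrow> Poly_Mapping.keys p \<subseteq> K \<Longrightarrow>
    lin_ext scale f p = (\<Sum>x\<in>K. scale (Poly_Mapping.lookup p x) (f x))"
  unfolding lin_ext_def by (rule sum.mono_neutral_left) (auto simp: in_keys_iff)

lemma linear_lin_ext: "Vector_Spaces.linear free_scale scale (lin_ext scale f)"
proof unfold_locales
  fix p q :: "'c \<Rightarrow>\<^sub>0 'a" and c
  let ?K = "Poly_Mapping.keys p \<union> Poly_Mapping.keys q"
  have "lin_ext scale f (p + q) = (\<Sum>x\<in>?K. scale (Poly_Mapping.lookup (p + q) x) (f x))"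
    by (rule lin_ext_superset) (auto simp: Poly_Mapping.keys_add)
  also have "\<dots> = (\<Sum>x\<in>?K. scale (Poly_Mapping.lookup p x) (f x)) +
      (\<Sum>x\<in>?K. scale (Poly_Mapping.lookup q x) (f x))"
    by (simp add: lookup_add scale_left_distrib sum.distrib)
  also have "\<dots> = lin_ext scale f p + lin_ext scale f q"
    by (simp add: lin_ext_superset[of ?K p] lin_ext_superset[of ?K q])
  finally show "lin_ext scale f (p + q) = lin_ext scale f p + lin_ext scale f q" .
  have "lin_ext scale f (free_scale c p) =
      (\<Sum>x\<in>Poly_Mapping.keys p. scale (Poly_Mapping.lookup (free_scale c p) x) (f x))"
    by (rule lin_ext_superset) (auto simp: in_keys_iff lookup_free_scale)
  then show "lin_ext scale f (free_scale c p) = scale c (lin_ext scale f p)"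
    by (simp add: lookup_free_scale lin_ext_def scale_sum_right)
qed

lemma lin_ext_gen: "lin_ext scale f (gen x) = f x"
  by (simp add: lin_ext_def)

lemma lin_ext_sum_list: "lin_ext scale f (\<Sum>x\<leftarrow>xs. gen x) = (\<Sum>x\<leftarrow>xs. f x)"
proof -
  interpret l: Vector_Spaces.linear free_scale scale "lin_ext scale f" by (rule linear_lin_ext)
  show ?thesis by (induction xs) (simp_all add: l.zero l.add lin_ext_gen)
qed

text \<open>A map that is bilinear modulo a subspace \<open>N\<close> induces a map on \<open>A \<otimes> A\<close>.\<close>

lemma tensors2_eqD:
  fixes sA :: "'a \<Rightarrow> 'e::ab_group_add \<Rightarrow> 'e"
  assumes eq: "tensors2 sA xs = tensors2 sA ys" and N: "subspace N"
    and "\<And>a a' b. f (a + a', b) - f (a, b) - f (a', b) \<in> N"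
    and "\<And>a b b'. f (a, b + b') - f (a, b) - f (a, b') \<in> N"
    and "\<And>c a b. f (sA c a, b) - scale c (f (a, b)) \<in> N"
    and "\<And>c a b. f (a, sA c b) - scale c (f (a, b)) \<in> N"
  shows "(\<Sum>x\<leftarrow>xs. f x) - (\<Sum>x\<leftarrow>ys. f x) \<in> N"
proof -
  interpret l: Vector_Spaces.linear free_scale scale "lin_ext scale f" by (rule linear_lin_ext)
  have "relations2 sA \<subseteq> lin_ext scale f -` N"
    using assms(3-) by (auto simp: relations2_def l.diff l.scale lin_ext_gen)
  moreover have "free.subspace (lin_ext scale f -` N)"
    by (rule l.subspace_vimage[OF N])
  ultimately have "null2 sA \<subseteq> lin_ext scale f -` N"
    unfolding null2_def by (rule free.span_minimal)
  moreover have "(\<Sum>x\<leftarrow>xs. gen x) - (\<Sum>x\<leftarrow>ys. gen x) \<in> null2 sA"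
    using eq by (simp add: tensors2_def coset_eq_iff[OF subspace_null2])
  ultimately show ?thesis by (auto simp: l.diff lin_ext_sum_list)
qed

end

context k_algebra
begin

lemma relations2_null2:
  "gen (a + a', b) - gen (a, b) - gen (a', b) \<in> null2 scale"
  "gen (a, b + b') - gen (a, b) - gen (a, b') \<in> null2 scale"
  "gen (scale c a, b) - free_scale c (gen (a, b)) \<in> null2 scale"
  "gen (a, scale c b) - free_scale c (gen (a, b)) \<in> null2 scale"
  unfolding null2_def relations2_def
     apply (rule free.span_base, rule UnI1, rule UnI1, rule UnI1, blast)
    apply (rule free.span_base, rule UnI1, rule UnI1, rule UnI2, blast)
   apply (rule free.span_base, rule UnI1, rule UnI2, blast)
  apply (rule free.span_base, rule UnI2, blast)
  done

lemma relations3_null3: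
  "gen (a + a', b, d) - gen (a, b, d) - gen (a', b, d) \<in> null3 scale"
  "gen (a, b + b', d) - gen (a, b, d) - gen (a, b', d) \<in> null3 scale"
  "gen (a, b, d + d') - gen (a, b, d) - gen (a, b, d') \<in> null3 scale"
  "gen (scale c a, b, d) - free_scale c (gen (a, b, d)) \<in> null3 scale"
  "gen (a, scale c b, d) - free_scale c (gen (a, b, d)) \<in> null3 scale"
  "gen (a, b, scale c d) - free_scale c (gen (a, b, d)) \<in> null3 scale"
  unfolding null3_def relations3_def
       apply (rule free.span_base, rule UnI1, rule UnI1, rule UnI1, rule UnI1, rule UnI1, blast)
      apply (rule free.span_base, rule UnI1, rule UnI1, rule UnI1, rule UnI1, rule UnI2, blast)
     apply (rule free.span_base, rule UnI1, rule UnI1, rule UnI1, rule UnI2, blast)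
    apply (rule free.span_base, rule UnI1, rule UnI1, rule UnI2, blast)
   apply (rule free.span_base, rule UnI1, rule UnI2, blast)
  apply (rule free.span_base, rule UnI2, blast)
  done

lemma tensors2_surj:
  assumes "r \<in> tensor_square scale"
  obtains xs where "r = tensors2 scale xs"
proof -
  have "\<exists>xs. coset (null2 scale) p = tensors2 scale xs" for p
  proof (induction p rule: update_induct)
    case const
    have "coset (null2 scale) 0 = tensors2 scale []" by (simp add: tensors2_def)
    then show ?case by blast
  next
    case (update p x c)
    obtain a b where x: "x = (a, b)" by (cases x)
    from update obtain xs where "coset (null2 scale) p = tensors2 scale xs" by blast
    then have "p - (\<Sum>x\<leftarrow>xs. gen x) \<in> null2 scale"
      by (simp add: tensors2_def coset_eq_iff[OF subspace_null2])
    moreover have "gen (scale c a, b) - free_scale c (gen (a, b)) \<in> null2 scale"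
      by (rule relations2_null2)
    ultimately have
      "p - (\<Sum>x\<leftarrow>xs. gen x) - (gen (scale c a, b) - free_scale c (gen (a, b))) \<in> null2 scale"
      by (rule free.subspace_diff[OF subspace_null2])
    moreover have "Poly_Mapping.update x c p = p + free_scale c (gen (a, b))"
      using update.hyps
      by (intro poly_mapping_eqI)
        (auto simp: x lookup_update lookup_add lookup_free_scale lookup_single when_def in_keys_iff)
    ultimately have "coset (null2 scale) (Poly_Mapping.update x c p) =
        tensors2 scale ((scale c a, b) # xs)"
      by (simp add: tensors2_def coset_eq_iff[OF subspace_null2] algebra_simps)
    then show ?case by blast
  qed
  with assms that show ?thesis unfolding tensor_square_def by blast
qed

lemma on_tensor_eq:
  assumes "\<And>ys. tensors2 scale xs = tensors2 scale ys \<Longrightarrow> F xs = F ys"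
  shows "on_tensor scale F (tensors2 scale xs) = F xs"
  unfolding on_tensor_def
proof (rule the_equality)
  show "\<forall>ys. tensors2 scale ys = tensors2 scale xs \<longrightarrow> F xs = F ys"
    using assms by metis
qed blast

lemma phi_tensors2:
  "phi scale (tensors2 scale xs) = (\<lambda>u\<in>dual scale. \<Sum>(a, b)\<leftarrow>xs. scale (u a) b)"
  unfolding phi_def
proof (rule on_tensor_eq, rule restrict_ext)
  fix ys u
  assume eq: "tensors2 scale xs = tensors2 scale ys" and u: "u \<in> dual scale"
  interpret u: Vector_Spaces.linear scale "(*)" u using u by (simp add: dual_def)
  have "(\<Sum>x\<leftarrow>xs. case x of (a, b) \<Rightarrow> scale (u a) b) -
      (\<Sum>x\<leftarrow>ys. case x of (a, b) \<Rightarrow> scale (u a) b) \<in> {0}"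
    by (rule tensors2_eqD[OF eq])
      (auto simp: u.add u.scale scale_left_distrib scale_right_distrib mult.commute)
  then show "(\<Sum>(a, b)\<leftarrow>xs. scale (u a) b) = (\<Sum>(a, b)\<leftarrow>ys. scale (u a) b)" by simp
qed

lemma flip_tensors2: "flip scale (tensors2 scale xs) = tensors2 scale [(b, a). (a, b) \<leftarrow> xs]"
  unfolding flip_def
proof (rule on_tensor_eq)
  fix ys assume eq: "tensors2 scale xs = tensors2 scale ys"
  have "(\<Sum>x\<leftarrow>xs. gen (case x of (a, b) \<Rightarrow> (b, a))) - (\<Sum>x\<leftarrow>ys. gen (case x of (a, b) \<Rightarrow> (b, a)))
      \<in> null2 scale"
    by (rule free.tensors2_eqD[OF eq subspace_null2]) (simp_all add: relations2_null2)
  then show "tensors2 scale [(b, a). (a, b) \<leftarrow> xs] = tensors2 scale [(b, a). (a, b) \<leftarrow> ys]"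
    by (simp add: tensors2_def coset_eq_iff[OF subspace_null2] o_def)
qed

text \<open>Quadratic expressions in the tensor are treated one argument at a time.\<close>

lemma tensors3_quadratic:
  fixes g :: "'a \<times> 'a \<Rightarrow> 'a \<times> 'a \<Rightarrow> 'a \<times> 'a \<times> 'a"
  assumes eq: "tensors2 scale xs = tensors2 scale ys"
    and left: "\<And>y zs. tensors2 scale xs = tensors2 scale zs \<Longrightarrow>
      (\<Sum>x\<leftarrow>xs. gen (g x y)) - (\<Sum>x\<leftarrow>zs. gen (g x y)) \<in> null3 scale"
    and right: "\<And>x zs. tensors2 scale xs = tensors2 scale zs \<Longrightarrow>
      (\<Sum>y\<leftarrow>xs. gen (g x y)) - (\<Sum>y\<leftarrow>zs. gen (g x y)) \<in> null3 scale"
  shows "tensors3 scale (concat (map (\<lambda>x. map (g x) xs) xs)) =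
    tensors3 scale (concat (map (\<lambda>x. map (g x) ys) ys))"
proof -
  have double: "(\<Sum>z\<leftarrow>concat (map (\<lambda>x. map (g x) vs) us). gen z) = (\<Sum>x\<leftarrow>us. \<Sum>y\<leftarrow>vs. gen (g x y))"
    for us vs by (induction us) (simp_all add: o_def)
  have add: "(\<Sum>x\<leftarrow>us. F x) - (\<Sum>x\<leftarrow>us. G x) \<in> null3 scale"
    if "\<And>x. F x - G x \<in> null3 scale" for us :: "('a \<times> 'a) list" and F G
  proof (induction us)
    case Nil
    show ?case using free.subspace_0[OF subspace_null3] by simp
  next
    case (Cons x us)
    from free.subspace_add[OF subspace_null3 that[of x] Cons.IH] show ?case
      by (simp add: algebra_simps)
  qed
  have swap: "(\<Sum>x\<leftarrow>us. \<Sum>y\<leftarrow>vs. H x y) = (\<Sum>y\<leftarrow>vs. \<Sum>x\<leftarrow>us. H x y)"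
    for us vs :: "('a \<times> 'a) list" and H :: "'a \<times> 'a \<Rightarrow> 'a \<times> 'a \<Rightarrow> ('a \<times> 'a \<times> 'a \<Rightarrow>\<^sub>0 'k)"
    by (induction us) (simp_all add: sum_list_addf)
  have "(\<Sum>x\<leftarrow>xs. \<Sum>y\<leftarrow>xs. gen (g x y)) - (\<Sum>x\<leftarrow>xs. \<Sum>y\<leftarrow>ys. gen (g x y)) \<in> null3 scale"
    by (intro add right eq)
  moreover have "(\<Sum>x\<leftarrow>xs. \<Sum>y\<leftarrow>ys. gen (g x y)) - (\<Sum>x\<leftarrow>ys. \<Sum>y\<leftarrow>ys. gen (g x y)) \<in> null3 scale"
  proof -
    have "(\<Sum>y\<leftarrow>ys. \<Sum>x\<leftarrow>xs. gen (g x y)) - (\<Sum>y\<leftarrow>ys. \<Sum>x\<leftarrow>ys. gen (g x y)) \<in> null3 scale"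
      by (intro add left eq)
    then show ?thesis
      by (subst swap[of _ ys xs], subst swap[of _ ys ys])
  qed
  ultimately have "(\<Sum>x\<leftarrow>xs. \<Sum>y\<leftarrow>xs. gen (g x y)) - (\<Sum>x\<leftarrow>ys. \<Sum>y\<leftarrow>ys. gen (g x y)) \<in> null3 scale"
    using free.subspace_add[OF subspace_null3] by fastforce
  then show ?thesis
    by (simp add: tensors3_def coset_eq_iff[OF subspace_null3] double)
qed

lemma r12_r13_tensors2:
  "r12_r13 scale (tensors2 scale xs) =
    tensors3 scale [(a * a', b, b'). (a, b) \<leftarrow> xs, (a', b') \<leftarrow> xs]"
  unfolding r12_r13_def
proof (rule on_tensor_eq)
  fix ys assume "tensors2 scale xs = tensors2 scale ys"
  then have "tensors3 scale (concat (map (\<lambda>x. map (\<lambda>y. (fst x * fst y, snd x, snd y)) xs) xs)) =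
      tensors3 scale (concat (map (\<lambda>x. map (\<lambda>y. (fst x * fst y, snd x, snd y)) ys) ys))"
  proof (rule tensors3_quadratic)
    fix x y :: "'a \<times> 'a" and zs assume eq: "tensors2 scale xs = tensors2 scale zs"
    show "(\<Sum>x\<leftarrow>xs. gen (fst x * fst y, snd x, snd y)) - (\<Sum>x\<leftarrow>zs. gen (fst x * fst y, snd x, snd y)) \<in> null3 scale"
      by (rule free.tensors2_eqD[OF eq subspace_null3])
        (simp_all add: distrib_left distrib_right relations3_null3
          flip: scale_mult_left scale_mult_right)
    show "(\<Sum>y\<leftarrow>xs. gen (fst x * fst y, snd x, snd y)) - (\<Sum>y\<leftarrow>zs. gen (fst x * fst y, snd x, snd y)) \<in> null3 scale"
      by (rule free.tensors2_eqD[OF eq subspace_null3])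
        (simp_all add: distrib_left distrib_right relations3_null3
          flip: scale_mult_left scale_mult_right)
  qed
  then show "tensors3 scale [(a * a', b, b'). (a, b) \<leftarrow> xs, (a', b') \<leftarrow> xs] =
      tensors3 scale [(a * a', b, b'). (a, b) \<leftarrow> ys, (a', b') \<leftarrow> ys]"
    by (simp only: split_def)
qed

lemma r13_r23_tensors2:
  "r13_r23 scale (tensors2 scale xs) =
    tensors3 scale [(a, a', b * b'). (a, b) \<leftarrow> xs, (a', b') \<leftarrow> xs]"
  unfolding r13_r23_def
proof (rule on_tensor_eq)
  fix ys assume "tensors2 scale xs = tensors2 scale ys"
  then have "tensors3 scale (concat (map (\<lambda>x. map (\<lambda>y. (fst x, fst y, snd x * snd y)) xs) xs)) =
      tensors3 scale (concat (map (\<lambda>x. map (\<lambda>y. (fst x, fst y, snd x * snd y)) ys) ys))"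
  proof (rule tensors3_quadratic)
    fix x y :: "'a \<times> 'a" and zs assume eq: "tensors2 scale xs = tensors2 scale zs"
    show "(\<Sum>x\<leftarrow>xs. gen (fst x, fst y, snd x * snd y)) - (\<Sum>x\<leftarrow>zs. gen (fst x, fst y, snd x * snd y)) \<in> null3 scale"
      by (rule free.tensors2_eqD[OF eq subspace_null3])
        (simp_all add: distrib_left distrib_right relations3_null3
          flip: scale_mult_left scale_mult_right)
    show "(\<Sum>y\<leftarrow>xs. gen (fst x, fst y, snd x * snd y)) - (\<Sum>y\<leftarrow>zs. gen (fst x, fst y, snd x * snd y)) \<in> null3 scale"
      by (rule free.tensors2_eqD[OF eq subspace_null3])
        (simp_all add: distrib_left distrib_right relations3_null3
          flip: scale_mult_left scale_mult_right)
  qed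
  then show "tensors3 scale [(a, a', b * b'). (a, b) \<leftarrow> xs, (a', b') \<leftarrow> xs] =
      tensors3 scale [(a, a', b * b'). (a, b) \<leftarrow> ys, (a', b') \<leftarrow> ys]"
    by (simp only: split_def)
qed

lemma r23_r12_tensors2:
  "r23_r12 scale (tensors2 scale xs) =
    tensors3 scale [(a, a' * b, b'). (a, b) \<leftarrow> xs, (a', b') \<leftarrow> xs]"
  unfolding r23_r12_def
proof (rule on_tensor_eq)
  fix ys assume "tensors2 scale xs = tensors2 scale ys"
  then have "tensors3 scale (concat (map (\<lambda>x. map (\<lambda>y. (fst x, fst y * snd x, snd y)) xs) xs)) =
      tensors3 scale (concat (map (\<lambda>x. map (\<lambda>y. (fst x, fst y * snd x, snd y)) ys) ys))"
  proof (rule tensors3_quadratic)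
    fix x y :: "'a \<times> 'a" and zs assume eq: "tensors2 scale xs = tensors2 scale zs"
    show "(\<Sum>x\<leftarrow>xs. gen (fst x, fst y * snd x, snd y)) - (\<Sum>x\<leftarrow>zs. gen (fst x, fst y * snd x, snd y)) \<in> null3 scale"
      by (rule free.tensors2_eqD[OF eq subspace_null3])
        (simp_all add: distrib_left distrib_right relations3_null3
          flip: scale_mult_left scale_mult_right)
    show "(\<Sum>y\<leftarrow>xs. gen (fst x, fst y * snd x, snd y)) - (\<Sum>y\<leftarrow>zs. gen (fst x, fst y * snd x, snd y)) \<in> null3 scale"
      by (rule free.tensors2_eqD[OF eq subspace_null3])
        (simp_all add: distrib_left distrib_right relations3_null3
          flip: scale_mult_left scale_mult_right)
  qed
  then show "tensors3 scale [(a, a' * b, b'). (a, b) \<leftarrow> xs, (a', b') \<leftarrow> xs] =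
      tensors3 scale [(a, a' * b, b'). (a, b) \<leftarrow> ys, (a', b') \<leftarrow> ys]"
    by (simp only: split_def)
qed

end

end

theory Submission
  imports Defs
begin

text \<open>
  With \<open>F = \<phi>(r)\<close> and its transpose \<open>G = \<phi>(\<sigma>(r))\<close>, pairing the left-hand side of the associative
  Yang-Baxter equation with \<open>u \<otimes> v \<otimes> w\<close> gives \<open>u(G v \<cdot> G w) + w(F u \<cdot> F v) - v(G w \<cdot> F u)\<close>, and
  such pairings separate the points of \<open>A \<otimes> A \<otimes> A\<close> because \<open>A\<close> has a finite basis. Put
  \<open>F = \<alpha> + \<beta>\<close> and \<open>G = - \<alpha> + \<beta>\<close> with \<open>\<alpha> = \<phi>(r\<^sub>-)\<close> skew and \<open>\<beta> = \<phi>(r\<^sub>+)\<close> a symmetric bimodule map.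
  The mixed terms cancel, the terms in \<open>\<beta>\<close> add up to \<open>w(\<beta> u \<cdot> \<beta> v)\<close>, and by skewness those in
  \<open>\<alpha>\<close> add up to \<open>w\<close> of the defect of \<open>\<alpha>\<close> from being an \<open>\<O>\<close>-operator. The balance condition on \<open>\<beta>\<close>
  holds automatically.
\<close>

section \<open>Sums over lists, linear functionals, and linearity modulo a subspace\<close>

lemma sum_list_product:
  fixes f :: "'x \<Rightarrow> 'b::semiring_0"
  shows "(\<Sum>x\<leftarrow>xs. f x) * (\<Sum>y\<leftarrow>ys. g y) = (\<Sum>x\<leftarrow>xs. \<Sum>y\<leftarrow>ys. f x * g y)"
  by (induction xs) (simp_all add: distrib_right sum_list_const_mult)

lemma sum_list_concat_map:
  fixes f :: "'z \<Rightarrow> 'b::comm_monoid_add"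
  shows "(\<Sum>z\<leftarrow>concat (map (\<lambda>x. map (g x) ys) xs). f z) = (\<Sum>x\<leftarrow>xs. \<Sum>y\<leftarrow>ys. f (g x y))"
  by (induction xs) (simp_all add: o_def)

lemma sum_list_swap:
  fixes f :: "'x \<Rightarrow> 'y \<Rightarrow> 'b::comm_monoid_add"
  shows "(\<Sum>x\<leftarrow>xs. \<Sum>y\<leftarrow>ys. f x y) = (\<Sum>y\<leftarrow>ys. \<Sum>x\<leftarrow>xs. f x y)"
  by (induction xs) (simp_all add: sum_list_addf)

lemma extensional_eq_iff:
  assumes "f \<in> extensional A" "g \<in> extensional A"
  shows "f = g \<longleftrightarrow> (\<forall>x\<in>A. f x = g x)"
  using extensionalityI[OF assms] by blast

lemma sum_fun_apply: "(\<Sum>x\<in>A. f x) y = (\<Sum>x\<in>A. f x y)"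
  for f :: "'x \<Rightarrow> 'y \<Rightarrow> 'b::comm_monoid_add"
  by (induction A rule: infinite_finite_induct) simp_all

lemma vector_space_self: "vector_space ((*) :: 'k::field \<Rightarrow> 'k \<Rightarrow> 'k)"
  by unfold_locales (auto simp: algebra_simps)

lemma dualD:
  assumes "u \<in> dual scale"
  shows "u (x + y) = u x + u y" "u (scale c x) = c * u x" "u (x - y) = u x - u y"
    "u (- x) = - u x" "u 0 = 0" "u (\<Sum>x\<in>A. f x) = (\<Sum>x\<in>A. u (f x))"
    "u (\<Sum>x\<leftarrow>xs. g x) = (\<Sum>x\<leftarrow>xs. u (g x))"
proof -
  interpret u: Vector_Spaces.linear scale "(*)" u using assms by (simp add: dual_def)
  show "u (x + y) = u x + u y" "u (scale c x) = c * u x" "u (x - y) = u x - u y"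
    "u (- x) = - u x" "u 0 = 0" "u (\<Sum>x\<in>A. f x) = (\<Sum>x\<in>A. u (f x))"
    by (simp_all add: u.add u.scale u.diff u.neg u.zero u.sum)
  show "u (\<Sum>x\<leftarrow>xs. g x) = (\<Sum>x\<leftarrow>xs. u (g x))"
    by (induction xs) (simp_all add: u.add u.zero)
qed

context vector_space
begin

lemma dualI:
  assumes "\<And>x y. u (x + y) = u x + u y" and "\<And>c x. u (scale c x) = c * u x"
  shows "u \<in> dual scale"
  unfolding dual_def mem_Collect_eq by unfold_locales (simp_all add: assms distrib_left distrib_right)

lemma dual_add:
  assumes "u \<in> dual scale" "v \<in> dual scale"
  shows "u + v \<in> dual scale"
  by (rule dualI) (simp_all add: dualD[OF assms(1)] dualD[OF assms(2)] algebra_simps)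

lemma dual_scale_apply: "dual_scale c u x = c * u x"
  by (simp add: dual_scale_def)

lemma dual_scale_dual:
  assumes "u \<in> dual scale"
  shows "dual_scale c u \<in> dual scale"
  by (rule dualI) (simp_all add: dual_scale_def dualD[OF assms] algebra_simps)

lemma dual_zero: "0 \<in> dual scale"
  by (rule dualI) simp_all

text \<open>Meant for \<open>g\<close> placing its argument in one slot of a generator, which is
  linear only modulo \<open>null3 scale\<close>. In the induction the defects of additivity, of
  scaling and of the smaller sum add up.\<close>

lemma linear_mod_sum:
  fixes sA :: "'a \<Rightarrow> 'e::ab_group_add \<Rightarrow> 'e"
  assumes N: "subspace N" and sA: "vector_space sA"
    and add: "\<And>x y. g (x + y) - g x - g y \<in> N"
    and scl: "\<And>c x. g (sA c x) - scale c (g x) \<in> N"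
  shows "g (\<Sum>b\<in>B. sA (c b) b) - (\<Sum>b\<in>B. scale (c b) (g b)) \<in> N"
proof -
  interpret A: vector_space sA by (rule sA)
  \<comment> \<open>The scaling hypothesis at \<open>c = 0\<close> and \<open>x = 0\<close>; it
    settles the empty sum and, by convention, infinite \<open>B\<close>.\<close>
  have zero: "g 0 \<in> N" using scl[of 0 0] by simp
  show ?thesis
  proof (induction B rule: infinite_finite_induct)
    case (insert b B)
    let ?s = "\<Sum>b\<in>B. sA (c b) b"
    have "g (sA (c b) b + ?s) - g (sA (c b) b) - g ?s + (g (sA (c b) b) - scale (c b) (g b))
        + (g ?s - (\<Sum>b\<in>B. scale (c b) (g b))) \<in> N"
      by (intro subspace_add[OF N] add scl insert.IH)
    then show ?case using insert.hyps by (simp add: algebra_simps)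
  qed (simp_all add: zero)
qed

end

section \<open>Multilinear forms separate tensors\<close>

text \<open>The tensor product of the functionals \<open>u\<close>, \<open>v\<close>,
  \<open>w\<close>, taken on the free space before passing to the quotient.\<close>

definition eval3 ::
  "('a \<Rightarrow> 'k::field) \<Rightarrow> ('a \<Rightarrow> 'k) \<Rightarrow> ('a \<Rightarrow> 'k) \<Rightarrow> ('a \<times> 'a \<times> 'a \<Rightarrow>\<^sub>0 'k) \<Rightarrow> 'k" where
  "eval3 u v w = lin_ext (*) (\<lambda>(a, b, d). u a * v b * w d)"

lemma eval3_linear: "Vector_Spaces.linear free_scale (*) (eval3 u v w)"
  unfolding eval3_def by (rule vector_space.linear_lin_ext[OF vector_space_self])

lemma eval3_simps:
  "eval3 u v w 0 = 0"
  "eval3 u v w (p + q) = eval3 u v w p + eval3 u v w q"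
  "eval3 u v w (p - q) = eval3 u v w p - eval3 u v w q"
  "eval3 u v w (free_scale c p) = c * eval3 u v w p"
proof -
  interpret e: Vector_Spaces.linear free_scale "(*)" "eval3 u v w" by (rule eval3_linear)
  show "eval3 u v w 0 = 0"
    "eval3 u v w (p + q) = eval3 u v w p + eval3 u v w q"
    "eval3 u v w (p - q) = eval3 u v w p - eval3 u v w q"
    "eval3 u v w (free_scale c p) = c * eval3 u v w p"
    by (rule e.zero e.add e.diff e.scale)+
qed

lemma eval3_gen [simp]: "eval3 u v w (gen (a, b, d)) = u a * v b * w d"
  unfolding eval3_def by (simp add: vector_space.lin_ext_gen[OF vector_space_self])

lemma eval3_sum_list: "eval3 u v w (\<Sum>x\<leftarrow>xs. gen x) = (\<Sum>(a, b, d)\<leftarrow>xs. u a * v b * w d)"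
  unfolding eval3_def by (simp add: vector_space.lin_ext_sum_list[OF vector_space_self])

text \<open>Each relation expresses linearity in one slot, which a product of three linear
  functionals respects; the kernel is a subspace and so contains the span.\<close>

lemma eval3_null3:
  assumes "u \<in> dual scale" "v \<in> dual scale" "w \<in> dual scale" "p \<in> null3 scale"
  shows "eval3 u v w p = 0"
proof -
  have "relations3 scale \<subseteq> eval3 u v w -` {0}"
    using assms(1-3)
    by (auto simp: relations3_def eval3_simps dualD[OF assms(1)] dualD[OF assms(2)]
        dualD[OF assms(3)] distrib_left distrib_right mult.assoc
        mult.left_commute)
  moreover have "free.subspace (eval3 u v w -` {0})"
    by (simp add: free.subspace_def eval3_simps)
  ultimately show ?thesis
    using free.span_minimal assms(4) unfolding null3_def by blast
qed

section \<open>Coordinates and the dual basis\<close>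

locale finite_dim_algebra = k_algebra scale + finite_dimensional_vector_space scale Basis
  for scale :: "'k::field \<Rightarrow> 'a::ring \<Rightarrow> 'a" and Basis
begin

text \<open>The dual basis functional of \<open>b\<close>, with the vector as last argument so that
  \<open>coord b\<close> is an element of \<open>dual scale\<close>.\<close>

definition coord :: "'a \<Rightarrow> 'a \<Rightarrow> 'k" where
  "coord b = (\<lambda>x. representation Basis x b)"

lemma coord_dual: "coord b \<in> dual scale"
  by (rule dualI)
    (simp_all add: coord_def span_Basis independent_Basis representation_add representation_scale)

lemma coord_expansion: "(\<Sum>b\<in>Basis. scale (coord b x) b) = x"
  unfolding coord_def
  by (rule sum_representation_eq[OF independent_Basis]) (simp_all add: span_Basis finite_Basis)

lemma dual_separates:
  assumes "\<And>u. u \<in> dual scale \<Longrightarrow> u x = u y"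
  shows "x = y"
proof -
  have "(\<Sum>b\<in>Basis. scale (coord b x) b) = (\<Sum>b\<in>Basis. scale (coord b y) b)"
    by (simp only: assms[OF coord_dual])
  then show ?thesis by (simp only: coord_expansion)
qed

lemma dual_eq_iff: "x = y \<longleftrightarrow> (\<forall>u\<in>dual scale. u x = u y)"
  using dual_separates[of x y] by blast

lemma dual_expansion:
  assumes "u \<in> dual scale"
  shows "(\<Sum>b\<in>Basis. dual_scale (u b) (coord b)) = u"
proof
  fix x
  have "u x = u (\<Sum>b\<in>Basis. scale (coord b x) b)" by (simp add: coord_expansion)
  also have "\<dots> = (\<Sum>b\<in>Basis. dual_scale (u b) (coord b) x)"
    by (simp only: dualD[OF assms]) (simp add: dual_scale_def mult.commute)
  finally show "(\<Sum>b\<in>Basis. dual_scale (u b) (coord b)) x = u x"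
    by (simp add: sum_fun_apply)
qed

text \<open>Modulo the relations each slot of a generator can be expanded in the basis, and the
  coefficients obtained are the values of \<open>eval3\<close> on triples of dual basis functionals.
  Induction over the support extends this to all \<open>p\<close>.\<close>

lemma null3_expansion:
  "p - (\<Sum>b\<in>Basis. \<Sum>b'\<in>Basis. \<Sum>b''\<in>Basis.
      free_scale (eval3 (coord b) (coord b') (coord b'') p) (gen (b, b', b''))) \<in> null3 scale"
    (is "p - ?E p \<in> _")
proof (induction p rule: update_induct)
  case const
  show ?case using free.subspace_0[OF subspace_null3] by (simp add: eval3_simps)
next
  case (update p x c)
  obtain a b d where x: "x = (a, b, d)" by (cases x)
  note closed = free.subspace_add[OF subspace_null3] free.subspace_scale[OF subspace_null3]
    free.subspace_sum[OF subspace_null3]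
  have 1: "gen (a, b, d) - (\<Sum>i\<in>Basis. free_scale (coord i a) (gen (i, b, d))) \<in> null3 scale"
    for a b d
    using free.linear_mod_sum[OF subspace_null3 vector_space_axioms,
        where g = "\<lambda>a. gen (a, b, d)" and c = "\<lambda>i. coord i a" and B = Basis]
    by (simp add: relations3_null3 coord_expansion)
  have 2: "gen (a, b, d) - (\<Sum>i\<in>Basis. free_scale (coord i b) (gen (a, i, d))) \<in> null3 scale"
    for a b d
    using free.linear_mod_sum[OF subspace_null3 vector_space_axioms,
        where g = "\<lambda>b. gen (a, b, d)" and c = "\<lambda>i. coord i b" and B = Basis]
    by (simp add: relations3_null3 coord_expansion)
  have 3: "gen (a, b, d) - (\<Sum>i\<in>Basis. free_scale (coord i d) (gen (a, b, i))) \<in> null3 scale"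
    for a b d
    using free.linear_mod_sum[OF subspace_null3 vector_space_axioms,
        where g = "\<lambda>d. gen (a, b, d)" and c = "\<lambda>i. coord i d" and B = Basis]
    by (simp add: relations3_null3 coord_expansion)
  let ?A = "\<lambda>f. \<Sum>i\<in>Basis. free_scale (coord i a) (f i)"
  let ?B = "\<lambda>f. \<Sum>i\<in>Basis. free_scale (coord i b) (f i)"
  let ?D = "\<lambda>f. \<Sum>i\<in>Basis. free_scale (coord i d) (f i)"
  \<comment> \<open>Fact \<open>1\<close> expands the first slot. Using \<open>2\<close> below the
    sum over that slot, then \<open>3\<close> below both sums, gives a telescoping chain from
    \<open>gen x\<close> to its full expansion.\<close>
  have "?A (\<lambda>i. gen (i, b, d) - ?B (\<lambda>j. gen (i, j, d))) \<in> null3 scale"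
    by (intro closed 2)
  then have second: "?A (\<lambda>i. gen (i, b, d)) - ?A (\<lambda>i. ?B (\<lambda>j. gen (i, j, d))) \<in> null3 scale"
    by (simp only: free.scale_right_diff_distrib sum_subtractf)
  have "?A (\<lambda>i. ?B (\<lambda>j. gen (i, j, d) - ?D (\<lambda>l. gen (i, j, l)))) \<in> null3 scale"
    by (intro closed 3)
  then have third: "?A (\<lambda>i. ?B (\<lambda>j. gen (i, j, d))) -
      ?A (\<lambda>i. ?B (\<lambda>j. ?D (\<lambda>l. gen (i, j, l)))) \<in> null3 scale"
    by (simp only: free.scale_right_diff_distrib sum_subtractf)
  have E: "?E (gen x) = ?A (\<lambda>i. ?B (\<lambda>j. ?D (\<lambda>l. gen (i, j, l))))"
    by (simp only: x eval3_gen free.scale_sum_right free.scale_scale mult.assoc)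
  have "gen x - ?E (gen x) \<in> null3 scale"
    unfolding E using closed(1)[OF closed(1)[OF 1[of a b d] second] third] by (simp add: x)
  from closed(1)[OF update.IH closed(2)[OF this, of c]]
  have step: "p - ?E p + free_scale c (gen x - ?E (gen x)) \<in> null3 scale" .
  \<comment> \<open>The induction adds a new key \<open>x\<close>, at which \<open>p\<close> is
    zero, so updating amounts to adding.\<close>
  have upd: "Poly_Mapping.update x c p = p + free_scale c (gen x)"
    using update.hyps
    by (intro poly_mapping_eqI)
      (auto simp: lookup_update lookup_add lookup_free_scale lookup_single when_def in_keys_iff)
  show ?case
  proof -
    have "?E (p + free_scale c (gen x)) = ?E p + free_scale c (?E (gen x))"
      by (simp only: eval3_simps free.scale_left_distrib sum.distrib free.scale_sum_right
          free.scale_scale)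
    then have "p + free_scale c (gen x) - ?E (p + free_scale c (gen x)) =
        p - ?E p + free_scale c (gen x - ?E (gen x))"
      unfolding free.scale_right_diff_distrib by (simp only: algebra_simps)
    then show ?thesis
      using step upd by (simp only:)
  qed
qed

text \<open>If all evaluations vanish, then so do those at dual basis triples, and the expansion
  leaves \<open>p\<close> itself in \<open>null3 scale\<close>. The converse is
  \<open>eval3_null3\<close>.\<close>

lemma null3_iff:
  "p \<in> null3 scale \<longleftrightarrow>
    (\<forall>u\<in>dual scale. \<forall>v\<in>dual scale. \<forall>w\<in>dual scale. eval3 u v w p = 0)"
  using eval3_null3 null3_expansion[of p] coord_dual by auto

end

section \<open>The map \<open>\<phi>\<close>\<close>

context k_algebra
begin

lemma dual_left_dual:
  assumes "u \<in> dual scale"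
  shows "dual_left x u \<in> dual scale"
  by (rule dualI) (simp_all add: dual_left_def dualD[OF assms] distrib_right flip: scale_mult_left)

lemma dual_right_dual:
  assumes "u \<in> dual scale"
  shows "dual_right x u \<in> dual scale"
  by (rule dualI) (simp_all add: dual_right_def dualD[OF assms] distrib_left flip: scale_mult_right)

text \<open>A clause of both operator definitions. The actions are transposes of right and left
  multiplication, so the bimodule laws reduce to associativity of the algebra.\<close>

lemma bimodule_dual: "bimodule scale (dual scale) dual_scale dual_left dual_right"
proof -
  interpret D: vector_space "dual_scale :: 'k \<Rightarrow> ('a \<Rightarrow> 'k) \<Rightarrow> ('a \<Rightarrow> 'k)"
    by unfold_locales (auto simp: dual_scale_def algebra_simps)
  have lin: "v (x * (y + z)) = v (x * y) + v (x * z)" "v ((x + y) * z) = v (x * z) + v (y * z)"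
      "v (scale c x * y) = c * v (x * y)" "v (x * scale c y) = c * v (x * y)"
    if v: "v \<in> dual scale" for v c x y z
    by (simp_all add: dualD[OF v] distrib_left distrib_right
        flip: scale_mult_left scale_mult_right)
  show ?thesis
    unfolding bimodule_def linear_on_def D.subspace_def
    by (auto simp: D.vector_space_axioms dual_zero dual_add dual_scale_dual dual_left_dual
        dual_right_dual)
      (auto simp: dual_left_def dual_right_def dual_scale_def lin mult.assoc)
qed

lemma scale_sum_list: "scale c (\<Sum>x\<leftarrow>xs. f x) = (\<Sum>x\<leftarrow>xs. scale c (f x))"
  by (induction xs) (simp_all add: scale_right_distrib)

lemma phi_Hom_dual:
  assumes "r \<in> tensor_square scale"
  shows "phi scale r \<in> Hom_dual scale"
proof -
  obtain xs where r: "r = tensors2 scale xs" using tensors2_surj assms by blast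
  show ?thesis
    unfolding Hom_dual_def linear_on_def r phi_tensors2
    by (simp add: dual_add dual_scale_dual split_def scale_left_distrib sum_list_addf
        scale_sum_list dual_scale_apply)
qed

lemma phi_coset_add:
  assumes "r \<in> tensor_square scale" "s \<in> tensor_square scale"
  shows "phi scale (coset_add (null2 scale) r s) = (\<lambda>u\<in>dual scale. phi scale r u + phi scale s u)"
proof -
  obtain xs ys where r: "r = tensors2 scale xs" and s: "s = tensors2 scale ys"
    using tensors2_surj assms by metis
  have "coset_add (null2 scale) r s = tensors2 scale (xs @ ys)"
    by (simp add: r s tensors2_def coset_add_coset[OF subspace_null2])
  then show ?thesis by (auto simp: r s phi_tensors2)
qed

lemma coset_add_tensor_square:
  assumes "r \<in> tensor_square scale" "s \<in> tensor_square scale"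
  shows "coset_add (null2 scale) r s \<in> tensor_square scale"
  using assms by (auto simp: tensor_square_def coset_add_coset[OF subspace_null2])

text \<open>If \<open>r\<close> is presented by pairs \<open>(a, b)\<close>, both sides are the sum
  of \<open>u a * v b\<close>. Thus \<open>phi\<close> turns the flip into the transpose.\<close>

lemma phi_flip_eq:
  assumes "r \<in> tensor_square scale" "u \<in> dual scale" "v \<in> dual scale"
  shows "u (phi scale (flip scale r) v) = v (phi scale r u)"
proof -
  obtain xs where r: "r = tensors2 scale xs" using tensors2_surj assms by blast
  show ?thesis using assms(2,3)
    by (simp add: r flip_tensors2 phi_tensors2 dualD[OF assms(2)] dualD[OF assms(3)]
        split_def o_def mult.commute)
qed

text \<open>The flip of \<open>r\<close> and \<open>r\<close> add up to zero; apply
  \<open>phi\<close> and pair with \<open>u\<close> through \<open>phi_flip_eq\<close>.\<close>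

lemma phi_Alt2:
  assumes "r \<in> Alt2 scale" "u \<in> dual scale" "v \<in> dual scale"
  shows "v (phi scale r u) = - u (phi scale r v)"
proof -
  have r: "r \<in> tensor_square scale" and flip: "flip scale r = coset_uminus (null2 scale) r"
    using assms by (simp_all add: Alt2_def)
  obtain p where p: "r = coset (null2 scale) p" using r by (auto simp: tensor_square_def)
  \<comment> \<open>The zero tensor is written with the empty presentation, so that
    \<open>phi_tensors2\<close> applies to it.\<close>
  have "coset_add (null2 scale) (flip scale r) r = tensors2 scale []"
    unfolding flip
    by (simp add: p coset_uminus_coset[OF subspace_null2] coset_add_coset[OF subspace_null2]
        tensors2_def)
  moreover have "flip scale r \<in> tensor_square scale"
    unfolding flip by (simp add: p coset_uminus_coset[OF subspace_null2] tensor_square_def)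
  ultimately have "phi scale (flip scale r) v + phi scale r v = 0"
    using phi_coset_add[OF _ r, of "flip scale r"] assms(3) by (simp add: phi_tensors2 fun_eq_iff)
      metis
  then have "phi scale (flip scale r) v = - phi scale r v" by (simp add: eq_neg_iff_add_eq_0)
  with phi_flip_eq[OF r assms(2,3)] show ?thesis by (simp add: dualD[OF assms(2)])
qed

end

section \<open>The transpose, its eigenspaces, and the two components of a map\<close>

context finite_dim_algebra
begin

lemma Hom_dual_expansion:
  assumes f: "f \<in> Hom_dual scale" and u: "u \<in> dual scale"
  shows "f u = (\<Sum>b\<in>Basis. scale (u b) (f (coord b)))"
proof -
  \<comment> \<open>Linearity of \<open>f\<close> is known on the dual only, so the induction also
    carries the membership of the partial sums.\<close>
  have "(\<Sum>b\<in>B. dual_scale (u b) (coord b)) \<in> dual scale \<and>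
    f (\<Sum>b\<in>B. dual_scale (u b) (coord b)) = (\<Sum>b\<in>B. scale (u b) (f (coord b)))" for B
  proof -
    have "f (0 + 0) = f 0 + f 0"
      using f dual_zero unfolding Hom_dual_def linear_on_def by blast
    then have "f 0 = 0" by simp
    then show ?thesis
      using f coord_dual
      by (induction B rule: infinite_finite_induct)
        (simp_all add: Hom_dual_def linear_on_def dual_zero dual_add dual_scale_dual)
  qed
  from this[of Basis] show ?thesis by (simp add: dual_expansion[OF u])
qed

text \<open>Reflexivity in coordinates: the vector described by \<open>THE\<close> exists by an
  explicit formula and is unique because functionals separate points.\<close>

lemma transp_eq_iff:
  assumes f: "f \<in> Hom_dual scale" and v: "v \<in> dual scale"
  shows "transp scale f v = x \<longleftrightarrow> (\<forall>u\<in>dual scale. u x = v (f u))"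
proof -
  \<comment> \<open>Taking \<open>u = coord b\<close> in the defining property forces these
    coordinates.\<close>
  let ?x = "\<Sum>b\<in>Basis. scale (v (f (coord b))) b"
  have "u ?x = v (f u)" if u: "u \<in> dual scale" for u
    by (simp add: Hom_dual_expansion[OF f u] dualD[OF u] dualD[OF v] mult.commute)
  then have iff: "(\<forall>u\<in>dual scale. u x = v (f u)) \<longleftrightarrow> x = ?x" for x
    by (simp add: dual_eq_iff[of x])
  then have "transp scale f v = ?x" using v by (simp add: transp_def)
  with iff show ?thesis by (simp add: eq_commute)
qed

lemma transp_extensional: "transp scale f \<in> extensional (dual scale)"
  by (simp add: transp_def)

text \<open>Replaces the eigenvalue condition by symmetry of the form sending \<open>u\<close> and
  \<open>v\<close> to \<open>u (f v)\<close>; \<open>Hom_minus_iff\<close> does so with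
  skewness.\<close>

lemma Hom_plus_iff:
  "f \<in> Hom_plus scale \<longleftrightarrow>
    f \<in> Hom_dual scale \<and> (\<forall>u\<in>dual scale. \<forall>v\<in>dual scale. u (f v) = v (f u))"
proof (cases "f \<in> Hom_dual scale")
  case True
  then have "f \<in> extensional (dual scale)" by (simp add: Hom_dual_def)
  note eq_iff = extensional_eq_iff[OF transp_extensional this]
  show ?thesis using True by (auto simp: Hom_plus_def eq_iff transp_eq_iff)
qed (simp add: Hom_plus_def)

lemma Hom_minus_iff:
  "f \<in> Hom_minus scale \<longleftrightarrow>
    f \<in> Hom_dual scale \<and> (\<forall>u\<in>dual scale. \<forall>v\<in>dual scale. u (f v) = - v (f u))"
proof (cases "f \<in> Hom_dual scale")
  case True
  note eq_iff = extensional_eq_iff[OF transp_extensional restrict_extensional]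
  have "transp scale f v = - f v \<longleftrightarrow> (\<forall>u\<in>dual scale. u (f v) = - v (f u))"
    if v: "v \<in> dual scale" for v
    unfolding transp_eq_iff[OF True v]
  proof (rule ball_cong[OF refl])
    fix u assume u: "u \<in> dual scale"
    show "u (- f v) = v (f u) \<longleftrightarrow> u (f v) = - v (f u)"
      unfolding dualD(4)[OF u] by (rule minus_equation_iff[THEN trans]) auto
  qed
  then show ?thesis using True by (auto simp: Hom_minus_def eq_iff)
qed (simp add: Hom_minus_def)

text \<open>Pair the equation at \<open>v\<close> with \<open>u\<close> and the one at
  \<open>u\<close> with \<open>v\<close>. Adding them cancels the skew parts and doubles the
  symmetric ones, and 2 is invertible.\<close>

lemma plus_minus_unique:
  assumes char: "CHAR('k) \<noteq> 2"
    and g: "g \<in> Hom_plus scale" "g' \<in> Hom_plus scale"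
    and h: "h \<in> Hom_minus scale" "h' \<in> Hom_minus scale"
    and eq: "(\<lambda>u\<in>dual scale. g u + h u) = (\<lambda>u\<in>dual scale. g' u + h' u)"
  shows "g = g'" "h = h'"
proof -
  \<comment> \<open>A characteristic dividing 2 but different from 2 would be 1, forcing 1 = 0 in
    the field.\<close>
  have two: "(2::'k) \<noteq> 0"
  proof
    assume "(2::'k) = 0"
    then have "CHAR('k) dvd 2" using of_nat_eq_0_iff_char_dvd[of 2, where 'a = 'k] by simp
    then have "CHAR('k) = 1" using char two_is_prime_nat unfolding prime_nat_iff by blast
    then show False using of_nat_CHAR[where 'a = 'k] by simp
  qed
  have sum: "g v + h v = g' v + h' v" if "v \<in> dual scale" for v
    using fun_cong[OF eq, of v] that by simp
  have gg: "g v = g' v" if v: "v \<in> dual scale" for v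
  proof (rule dual_separates)
    fix u assume u: "u \<in> dual scale"
    have "u (g v) + u (h v) = u (g' v) + u (h' v)"
      using sum[OF v] by (simp flip: dualD(1)[OF u])
    moreover have "v (g u) + v (h u) = v (g' u) + v (h' u)"
      using sum[OF u] by (simp flip: dualD(1)[OF v])
    moreover have "u (g v) = v (g u)" "u (g' v) = v (g' u)" "u (h v) = - v (h u)"
      "u (h' v) = - v (h' u)"
      using g h u v unfolding Hom_plus_iff Hom_minus_iff by blast+
    ultimately have "u (g v) + u (h v) + (u (g v) - u (h v)) =
        u (g' v) + u (h' v) + (u (g' v) - u (h' v))"
      by simp
    then have "2 * u (g v) = 2 * u (g' v)" by (simp flip: mult_2)
    then show "u (g v) = u (g' v)" using two by simp
  qed
  have hh: "h v = h' v" if "v \<in> dual scale" for v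
    using sum[OF that] gg[OF that] by simp
  have "g \<in> extensional (dual scale)" "g' \<in> extensional (dual scale)"
    "h \<in> extensional (dual scale)" "h' \<in> extensional (dual scale)"
    using g h by (auto simp: Hom_plus_def Hom_minus_def Hom_dual_def)
  with gg hh show "g = g'" "h = h'" by (meson extensionalityI)+
qed

lemma parts_eq:
  assumes "CHAR('k) \<noteq> 2" and "g \<in> Hom_plus scale" and "h \<in> Hom_minus scale"
    and "f = (\<lambda>u\<in>dual scale. g u + h u)"
  shows "plus_part scale f = g" "minus_part scale f = h"
  unfolding plus_part_def minus_part_def
  by (rule the_equality; use assms plus_minus_unique[OF assms(1)] in blast)+

lemma phi_Hom_minus: "r \<in> Alt2 scale \<Longrightarrow> phi scale r \<in> Hom_minus scale"
  unfolding Hom_minus_iff using phi_Hom_dual phi_Alt2 unfolding Alt2_def by blast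

section \<open>The associative Yang-Baxter equation as an operator identity\<close>

text \<open>\<open>F\<close> contracts the first leg of the tensor and \<open>G\<close> the second.
  In each of the three products the two legs that are not multiplied are contracted by functionals,
  and the remaining functional is applied to the product.\<close>

lemma AYBE_iff:
  assumes r: "r \<in> tensor_square scale"
  defines "F \<equiv> phi scale r" and "G \<equiv> phi scale (flip scale r)"
  shows "AYBE scale r \<longleftrightarrow>
    (\<forall>u\<in>dual scale. \<forall>v\<in>dual scale. \<forall>w\<in>dual scale.
      u (G v * G w) + w (F u * F v) - v (G w * F u) = 0)"
proof -
  obtain xs where xs: "r = tensors2 scale xs" using tensors2_surj r by blast
  let ?l1 = "concat (map (\<lambda>x. map (\<lambda>y. (fst x * fst y, snd x, snd y)) xs) xs)"
  let ?l2 = "concat (map (\<lambda>x. map (\<lambda>y. (fst x, fst y, snd x * snd y)) xs) xs)"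
  let ?l3 = "concat (map (\<lambda>x. map (\<lambda>y. (fst x, fst y * snd x, snd y)) xs) xs)"
  let ?p = "(\<Sum>x\<leftarrow>?l1. gen x) + (\<Sum>x\<leftarrow>?l2. gen x) - (\<Sum>x\<leftarrow>?l3. gen x)"
  have "AYBE scale r \<longleftrightarrow> ?p \<in> null3 scale"
    unfolding AYBE_def xs r12_r13_tensors2 r13_r23_tensors2 r23_r12_tensors2 tensors3_def split_def
      coset_uminus_coset[OF subspace_null3] coset_add_coset[OF subspace_null3]
      coset_eq_iff[OF subspace_null3]
    by simp
  also have "\<dots> \<longleftrightarrow> (\<forall>u\<in>dual scale. \<forall>v\<in>dual scale. \<forall>w\<in>dual scale. eval3 u v w ?p = 0)"
    by (rule null3_iff)
  also have "\<dots> \<longleftrightarrow> (\<forall>u\<in>dual scale. \<forall>v\<in>dual scale. \<forall>w\<in>dual scale.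
      u (G v * G w) + w (F u * F v) - v (G w * F u) = 0)"
  proof (intro ball_cong refl)
    fix u v w assume u: "u \<in> dual scale" and v: "v \<in> dual scale" and w: "w \<in> dual scale"
    have F: "F z = (\<Sum>x\<leftarrow>xs. scale (z (fst x)) (snd x))" if "z \<in> dual scale" for z
      using that by (simp add: F_def xs phi_tensors2 split_def)
    have G: "G z = (\<Sum>x\<leftarrow>xs. scale (z (snd x)) (fst x))" if "z \<in> dual scale" for z
      using that by (simp add: G_def xs flip_tensors2 phi_tensors2 split_def o_def)
    have eval: "eval3 u v w (\<Sum>z\<leftarrow>concat (map (\<lambda>x. map (g x) xs) xs). gen z) =
        (\<Sum>x\<leftarrow>xs. \<Sum>y\<leftarrow>xs. case g x y of (a, b, d) \<Rightarrow> u a * v b * w d)" for g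
      by (subst eval3_sum_list) (rule sum_list_concat_map)
    have "eval3 u v w (\<Sum>x\<leftarrow>?l1. gen x) = u (G v * G w)"
      unfolding eval
      by (simp add: G u v w sum_list_product dualD[OF u]
          ac_simps flip: scale_mult_left scale_mult_right)
    moreover have "eval3 u v w (\<Sum>x\<leftarrow>?l2. gen x) = w (F u * F v)"
      unfolding eval
      by (simp add: F u v w sum_list_product dualD[OF w]
          ac_simps flip: scale_mult_left scale_mult_right)
    moreover have "eval3 u v w (\<Sum>x\<leftarrow>?l3. gen x) = v (G w * F u)"
      unfolding eval
      \<comment> \<open>In \<open>G w * F u\<close> the left factor stems from the second copy of
        the tensor, so that copy must be the outer sum.\<close>
      by (subst sum_list_swap) (simp add: F G u v w sum_list_product dualD[OF v]
          ac_simps flip: scale_mult_left scale_mult_right)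
    ultimately show "eval3 u v w ?p = 0 \<longleftrightarrow> u (G v * G w) + w (F u * F v) - v (G w * F u) = 0"
      by (simp add: eval3_simps)
  qed
  finally show ?thesis .
qed

text \<open>Stated for abstract \<alpha> and \<beta>, so that the extended operator and, with
  \<beta> zero, the operator of weight zero are both instances.\<close>

lemma AYBE_iff_operator:
  assumes r: "r \<in> tensor_square scale"
    and phi: "\<And>u. u \<in> dual scale \<Longrightarrow> phi scale r u = \<alpha> u + \<beta> u"
    and \<alpha>: "\<alpha> \<in> Hom_minus scale" and \<beta>: "\<beta> \<in> Hom_bim_plus scale"
  shows "AYBE scale r \<longleftrightarrow>
    (\<forall>u\<in>dual scale. \<forall>v\<in>dual scale.
      \<alpha> u * \<alpha> v - \<alpha> (dual_left (\<alpha> u) v + dual_right (\<alpha> v) u) = - (\<beta> u * \<beta> v))"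
proof -
  have anti: "v (\<alpha> u) = - u (\<alpha> v)" if "u \<in> dual scale" "v \<in> dual scale" for u v
    using \<alpha> that unfolding Hom_minus_iff by blast
  have sym: "v (\<beta> u) = u (\<beta> v)" if "u \<in> dual scale" "v \<in> dual scale" for u v
    using \<beta> that unfolding Hom_bim_plus_def mem_Collect_eq Hom_plus_iff by blast
  have left: "\<beta> (dual_left x u) = x * \<beta> u" if "u \<in> dual scale" for x u
    using \<beta> that by (simp add: Hom_bim_plus_def bimodule_hom_def)
  \<comment> \<open>The flip acts as the transpose, which changes the sign of the skew part
    only.\<close>
  have G: "phi scale (flip scale r) v = - \<alpha> v + \<beta> v" if v: "v \<in> dual scale" for v
  proof (rule dual_separates)
    fix u assume u: "u \<in> dual scale"
    show "u (phi scale (flip scale r) v) = u (- \<alpha> v + \<beta> v)"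
      using phi_flip_eq[OF r u v] phi[OF u] anti[OF u v] sym[OF u v] by (simp add: dualD[OF u] dualD[OF v])
  qed
  \<comment> \<open>This cancels the mixed terms in \<open>\<alpha>\<close> and \<open>\<beta>\<close> and identifies the three terms in \<open>\<beta>\<close>.\<close>
  have l: "u (x * \<beta> w) = w (\<beta> u * x)" if "u \<in> dual scale" "w \<in> dual scale" for u w x
  proof -
    have "u (x * \<beta> w) = u (\<beta> (dual_left x w))" by (simp add: left that)
    also have "\<dots> = dual_left x w (\<beta> u)" by (rule sym) (simp_all add: dual_left_dual that)
    finally show ?thesis by (simp add: dual_left_def)
  qed
  have "AYBE scale r \<longleftrightarrow> (\<forall>u\<in>dual scale. \<forall>v\<in>dual scale. \<forall>w\<in>dual scale.
    w (\<alpha> u * \<alpha> v - \<alpha> (dual_left (\<alpha> u) v + dual_right (\<alpha> v) u)) = w (- (\<beta> u * \<beta> v)))"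
    unfolding AYBE_iff[OF r]
  proof (intro ball_cong refl)
    fix u v w assume u: "u \<in> dual scale" and v: "v \<in> dual scale" and w: "w \<in> dual scale"
    have "w (\<alpha> (dual_left (\<alpha> u) v + dual_right (\<alpha> v) u)) =
        - (dual_left (\<alpha> u) v + dual_right (\<alpha> v) u) (\<alpha> w)"
      by (intro anti dual_add dual_left_dual dual_right_dual u v w)
    then have \<alpha>\<alpha>: "w (\<alpha> (dual_left (\<alpha> u) v + dual_right (\<alpha> v) u)) =
        - v (\<alpha> w * \<alpha> u) - u (\<alpha> v * \<alpha> w)"
      by (simp add: dual_left_def dual_right_def)
    \<comment> \<open>The first three equations match mixed terms of opposite sign. The last two
      make the pure \<beta> terms equal; with signs plus, plus, minus one of them survives.\<close>
    have mixed: "u (\<alpha> v * \<beta> w) = w (\<beta> u * \<alpha> v)" "v (\<alpha> w * \<beta> u) = u (\<beta> v * \<alpha> w)"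
        "w (\<alpha> u * \<beta> v) = v (\<beta> w * \<alpha> u)"
      "u (\<beta> v * \<beta> w) = w (\<beta> u * \<beta> v)" "v (\<beta> w * \<beta> u) = u (\<beta> v * \<beta> w)"
      by (rule l; rule u v w)+
    show "u (phi scale (flip scale r) v * phi scale (flip scale r) w)
          + w (phi scale r u * phi scale r v) - v (phi scale (flip scale r) w * phi scale r u) = 0
        \<longleftrightarrow> w (\<alpha> u * \<alpha> v - \<alpha> (dual_left (\<alpha> u) v + dual_right (\<alpha> v) u)) = w (- (\<beta> u * \<beta> v))"
      using mixed
      by (simp add: G phi u v w dualD[OF u] dualD[OF v] dualD[OF w] distrib_left distrib_right \<alpha>\<alpha>
          left_diff_distrib right_diff_distrib)
        (simp add: algebra_simps eq_neg_iff_add_eq_0)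
  qed
  also have "\<dots> \<longleftrightarrow> (\<forall>u\<in>dual scale. \<forall>v\<in>dual scale.
      \<alpha> u * \<alpha> v - \<alpha> (dual_left (\<alpha> u) v + dual_right (\<alpha> v) u) = - (\<beta> u * \<beta> v))"
    by (simp only: dual_eq_iff[symmetric])
  finally show ?thesis .
qed

section \<open>The balance condition and the two equivalences\<close>

text \<open>At \<open>y\<close> the left side is \<open>v\<close> applied to
  \<open>y * \<beta> u\<close>. Equivariance moves \<open>y\<close> inside \<beta>, and symmetry
  then exchanges \<open>u\<close> and \<open>v\<close>.\<close>

lemma Hom_bim_plus_balanced:
  assumes \<beta>: "\<beta> \<in> Hom_bim_plus scale" and u: "u \<in> dual scale" and v: "v \<in> dual scale"
  shows "dual_left (\<beta> u) v = dual_right (\<beta> v) u"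
proof
  fix y
  have "v (\<beta> (dual_left y u)) = dual_left y u (\<beta> v)"
    using \<beta> dual_left_dual[OF u] v unfolding Hom_bim_plus_def mem_Collect_eq Hom_plus_iff by blast
  moreover have "\<beta> (dual_left y u) = y * \<beta> u"
    using \<beta> u by (simp add: Hom_bim_plus_def bimodule_hom_def)
  ultimately show "dual_left (\<beta> u) v y = dual_right (\<beta> v) u y"
    by (simp add: dual_left_def dual_right_def)
qed

text \<open>Serves as \<beta> for alternating \<open>r\<close>; the restriction supplies the
  extensionality required by \<open>Hom_dual\<close>.\<close>

lemma zero_Hom_bim_plus: "(\<lambda>u\<in>dual scale. 0) \<in> Hom_bim_plus scale"
  unfolding Hom_bim_plus_def mem_Collect_eq Hom_plus_iff
  by (auto simp: Hom_dual_def linear_on_def bimodule_hom_def dual_add dual_scale_dual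
      dual_left_dual dual_right_dual dualD(5))

lemma AYBE_iff_extended_O_operator:
  assumes "s \<in> Alt2 scale" and "t \<in> Sym2_bim scale"
  shows "AYBE scale (coset_add (null2 scale) s t) \<longleftrightarrow>
    extended_O_operator scale (dual scale) dual_scale dual_left dual_right (- 1)
      (phi scale s) (phi scale t)"
proof -
  have s: "s \<in> tensor_square scale" and t: "t \<in> tensor_square scale"
    and bim: "phi scale t \<in> Hom_bim_plus scale"
    using assms by (simp_all add: Alt2_def Sym2_bim_def)
  have "linear_on (dual scale) dual_scale scale (phi scale s)"
    "linear_on (dual scale) dual_scale scale (phi scale t)"
    using phi_Hom_dual s t by (simp_all add: Hom_dual_def)
  moreover have "AYBE scale (coset_add (null2 scale) s t) \<longleftrightarrow>
    (\<forall>u\<in>dual scale. \<forall>v\<in>dual scale. phi scale s u * phi scale s v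
      - phi scale s (dual_left (phi scale s u) v + dual_right (phi scale s v) u)
      = - (phi scale t u * phi scale t v))"
    by (rule AYBE_iff_operator)
      (simp_all add: s t bim coset_add_tensor_square phi_coset_add phi_Hom_minus assms)
  ultimately show ?thesis
    unfolding extended_O_operator_def
    by (simp add: bimodule_dual Hom_bim_plus_balanced[OF bim])
qed

lemma AYBE_iff_O_operator0:
  assumes "r \<in> Alt2 scale"
  shows "AYBE scale r \<longleftrightarrow>
    O_operator0 scale (dual scale) dual_scale dual_left dual_right (phi scale r)"
proof -
  have r: "r \<in> tensor_square scale" using assms by (simp add: Alt2_def)
  have lin: "linear_on (dual scale) dual_scale scale (phi scale r)"
    using phi_Hom_dual r by (simp add: Hom_dual_def)
  have "AYBE scale r \<longleftrightarrow>
    (\<forall>u\<in>dual scale. \<forall>v\<in>dual scale. phi scale r u * phi scale r v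
      - phi scale r (dual_left (phi scale r u) v + dual_right (phi scale r v) u)
      = - ((\<lambda>u\<in>dual scale. 0) u * (\<lambda>u\<in>dual scale. 0) v))"
    by (rule AYBE_iff_operator[OF r _ phi_Hom_minus[OF assms] zero_Hom_bim_plus]) simp
  \<comment> \<open>Additivity on the dual splits the value at the sum of the two actions into the
    two terms of \<open>O_operator0\<close>.\<close>
  with lin show ?thesis
    unfolding O_operator0_def
    by (simp add: bimodule_dual linear_on_def dual_left_dual dual_right_dual)
qed

end

theorem theorem1p4:
  fixes scale :: "'k::field \<Rightarrow> 'a::ring \<Rightarrow> 'a"
  assumes "CHAR('k) \<noteq> 2" and "k_algebra scale" and "finite_dim scale"
  shows
    "(\<forall>r r_minus r_plus.
        r_minus \<in> Alt2 scale \<and> r_plus \<in> Sym2_bim scale \<and>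
        r = coset_add (null2 scale) r_minus r_plus \<longrightarrow>
        (minus_part scale (phi scale r), plus_part scale (phi scale r)) =
          (phi scale r_minus, phi scale r_plus) \<and>
        (AYBE scale r \<longleftrightarrow>
          extended_O_operator scale (dual scale) dual_scale dual_left dual_right (- 1)
            (minus_part scale (phi scale r)) (plus_part scale (phi scale r)))) \<and>
     (\<forall>r \<in> Alt2 scale.
        AYBE scale r \<longleftrightarrow>
          O_operator0 scale (dual scale) dual_scale dual_left dual_right (phi scale r))"
proof -
  obtain B where "finite_dimensional_vector_space scale B"
    using assms(3) by (auto simp: finite_dim_def)
  then interpret finite_dim_algebra scale B
    using assms(2) by (simp add: finite_dim_algebra_def)
  have parts: "plus_part scale (phi scale (coset_add (null2 scale) s t)) = phi scale t"
    "minus_part scale (phi scale (coset_add (null2 scale) s t)) = phi scale s"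
    if s: "s \<in> Alt2 scale" and t: "t \<in> Sym2_bim scale" for s t
  proof -
    \<comment> \<open>The summands are exchanged because \<open>parts_eq\<close> expects the
      symmetric part first.\<close>
    have "phi scale (coset_add (null2 scale) s t) =
        (\<lambda>u\<in>dual scale. phi scale t u + phi scale s u)"
      using s t by (simp add: phi_coset_add Alt2_def Sym2_bim_def add.commute)
    moreover have "phi scale t \<in> Hom_plus scale"
      using t by (simp add: Sym2_bim_def Hom_bim_plus_def)
    ultimately show "plus_part scale (phi scale (coset_add (null2 scale) s t)) = phi scale t"
      "minus_part scale (phi scale (coset_add (null2 scale) s t)) = phi scale s"
      using parts_eq[OF assms(1)] phi_Hom_minus[OF s] by blast+
  qed
  then show ?thesis
    using AYBE_iff_extended_O_operator AYBE_iff_O_operator0 by auto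
qed

end
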